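(* There exist a tree metric, an initial configuration of the $k$ servers, and a request sequence $\sigma$ on that metric such that, when DCA is run on $\sigma$, some server incurs cost $\Omega(k\cdot\mathrm{OPT}(\sigma))$ (the hidden constant being independent of $k$), where $\mathrm{OPT}(\sigma)$ denotes the cost of the offline optimal solution.
   Context: $k$-server problem: $k$ servers in a metric space serve a sequence of requests (points); after request $\sigma_t$ some server must be at $\sigma_t$, moving costs the distance traveled, and a server's cost is its total distance moved; $\mathrm{OPT}(\sigma)$ is the minimum total cost of any offline solution from the same initial configuration. A tree metric is the set of points of an edge-weighted tree (including interior points of edges) with shortest-path distance. Double Coverage Algorithm (DCA): when a request arrives at $r$, all servers that are unblocked (no other server lies on their unique path to $r$) move toward $r$ at equal speed; a server that becomes blocked stops; movement halts when some server reaches $r$. *)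

theory Defs
  imports Complex_Main
begin

section \<open>Tree metrics\<close>

record 'v wgraph =
  verts :: "'v set"
  edges :: "'v set set"
  weight :: "'v set \<Rightarrow> real"

definition simple_path :: "'v wgraph \<Rightarrow> 'v \<Rightarrow> 'v list \<Rightarrow> 'v \<Rightarrow> bool" where
  "simple_path G u xs v \<longleftrightarrow>
     xs \<noteq> [] \<and> hd xs = u \<and> last xs = v \<and> distinct xs \<and> set xs \<subseteq> verts G \<and>
     successively (\<lambda>a b. {a, b} \<in> edges G) xs"

definition weighted_tree :: "'v wgraph \<Rightarrow> bool" where
  "weighted_tree G \<longleftrightarrow>
     finite (verts G) \<and> verts G \<noteq> {} \<and>
     edges G \<subseteq> {{u, v} | u v. u \<in> verts G \<and> v \<in> verts G \<and> u \<noteq> v} \<and>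
     (\<forall>e\<in>edges G. weight G e > 0) \<and>
     (\<forall>u\<in>verts G. \<forall>v\<in>verts G. \<exists>!xs. simple_path G u xs v)"

text \<open>
  A point of the tree, possibly interior to an edge, is given by its barycentric coordinates:
  the point at distance \<open>s * weight G {u, v}\<close> from \<open>u\<close> on the edge \<open>{u, v}\<close> is the function
  mapping \<open>u\<close> to \<open>1 - s\<close>, \<open>v\<close> to \<open>s\<close> and every other vertex to \<open>0\<close>. The vertex \<open>v\<close> itself is the
  indicator function of \<open>{v}\<close>, whichever edge it is regarded as an end of, so the representation
  of points is unique.
\<close>

type_synonym 'v point = "'v \<Rightarrow> real"

definition cell_points :: "'v set \<Rightarrow> 'v point set" where
  "cell_points e = {p. (\<forall>x. 0 \<le> p x) \<and> (\<forall>x. x \<notin> e \<longrightarrow> p x = 0) \<and> (\<Sum>x\<in>e. p x) = 1}"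

definition tree_points :: "'v wgraph \<Rightarrow> 'v point set" where
  "tree_points G = (\<Union>v\<in>verts G. cell_points {v}) \<union> (\<Union>e\<in>edges G. cell_points e)"

text \<open>
  On an edge \<open>e = {u, v}\<close> the coordinates at \<open>u\<close> and at \<open>v\<close> change by the same absolute value,
  which explains the division by two.
\<close>

definition segment_length :: "'v wgraph \<Rightarrow> 'v set \<Rightarrow> 'v point \<Rightarrow> 'v point \<Rightarrow> real" where
  "segment_length G e p q = weight G e * (\<Sum>x\<in>e. \<bar>p x - q x\<bar>) / 2"

text \<open>\<open>route G p q L\<close>: one can go from \<open>p\<close> to \<open>q\<close> by finitely many segments, each inside one edge,
  of total length \<open>L\<close>.\<close>

inductive route :: "'v wgraph \<Rightarrow> 'v point \<Rightarrow> 'v point \<Rightarrow> real \<Rightarrow> bool" for G where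
  stay: "p \<in> tree_points G \<Longrightarrow> route G p p 0"
| step: "e \<in> edges G \<Longrightarrow> p \<in> cell_points e \<Longrightarrow> q \<in> cell_points e \<Longrightarrow> route G q r L \<Longrightarrow>
           route G p r (segment_length G e p q + L)"

definition tree_dist :: "'v wgraph \<Rightarrow> 'v point \<Rightarrow> 'v point \<Rightarrow> real" where
  "tree_dist G p q = Inf {L. route G p q L}"

text \<open>In a tree the unique path between two points is the geodesic segment.\<close>

definition tree_path :: "'v wgraph \<Rightarrow> 'v point \<Rightarrow> 'v point \<Rightarrow> 'v point set" where
  "tree_path G p q = {x \<in> tree_points G. tree_dist G p x + tree_dist G x q = tree_dist G p q}"


section \<open>The server problem\<close>

text \<open>
  The servers are \<open>0, \<dots>, k - 1\<close>; the values of a configuration at other indices are irrelevant.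
  A run or schedule for \<open>\<sigma>\<close> is the list of the \<open>length \<sigma> + 1\<close> configurations before
  the first request and after each request.
\<close>

type_synonym 'v config = "nat \<Rightarrow> 'v point"

definition server_cost :: "'v wgraph \<Rightarrow> 'v config list \<Rightarrow> nat \<Rightarrow> real" where
  "server_cost G cs i = (\<Sum>t<length cs - 1. tree_dist G ((cs ! t) i) ((cs ! Suc t) i))"

definition offline_solution ::
    "'v wgraph \<Rightarrow> nat \<Rightarrow> 'v config \<Rightarrow> 'v point list \<Rightarrow> 'v config list \<Rightarrow> bool" where
  "offline_solution G k C \<sigma> cs \<longleftrightarrow>
     length cs = Suc (length \<sigma>) \<and> cs ! 0 = C \<and>
     (\<forall>t\<le>length \<sigma>. \<forall>i<k. (cs ! t) i \<in> tree_points G) \<and>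
     (\<forall>t<length \<sigma>. \<exists>i<k. (cs ! Suc t) i = \<sigma> ! t)"

definition OPT :: "'v wgraph \<Rightarrow> nat \<Rightarrow> 'v config \<Rightarrow> 'v point list \<Rightarrow> real" where
  "OPT G k C \<sigma> = Inf {(\<Sum>i<k. server_cost G cs i) | cs. offline_solution G k C \<sigma> cs}"


section \<open>Double coverage\<close>

text \<open>
  Servers at the same point do not block each other in this sense; among those, the
  movement rule below lets exactly one go on.
\<close>

definition blocked :: "'v wgraph \<Rightarrow> nat \<Rightarrow> 'v point \<Rightarrow> 'v config \<Rightarrow> nat \<Rightarrow> bool" where
  "blocked G k r P i \<longleftrightarrow> (\<exists>j<k. P j \<noteq> P i \<and> P j \<in> tree_path G (P i) r)"

text \<open>
  Serving a request at \<open>r\<close> takes time \<open>T\<close>, all servers having speed one. Once a server is blocked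
  it stays blocked until \<open>r\<close> is reached, because its blocker moves along the same path
  towards \<open>r\<close>. Hence server \<open>i\<close> moves towards \<open>r\<close> exactly up to some time \<open>stop i\<close>, and
  at time \<open>t < T\<close> the moving servers are those with \<open>t < stop i\<close>. Ties between
  unblocked servers at the same point are broken arbitrarily.
\<close>

definition dca_serve ::
    "'v wgraph \<Rightarrow> nat \<Rightarrow> 'v point \<Rightarrow> 'v config \<Rightarrow> 'v config \<Rightarrow> bool" where
  "dca_serve G k r C C' \<longleftrightarrow>
     (\<exists>(T::real) (stop :: nat \<Rightarrow> real) (pos :: real \<Rightarrow> 'v config).
        0 \<le> T \<and>
        (\<forall>i<k. 0 \<le> stop i \<and> stop i \<le> T) \<and>
        (\<forall>i<k. \<forall>t\<in>{0..T}. pos t i \<in> tree_path G (C i) r \<and>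
                            tree_dist G (C i) (pos t i) = min t (stop i)) \<and>
        (\<forall>t\<in>{0..<T}.
           (\<forall>i<k. pos t i \<noteq> r) \<and>
           (\<forall>i<k. t < stop i \<longrightarrow> \<not> blocked G k r (pos t) i) \<and>
           (\<forall>i<k. \<not> blocked G k r (pos t) i \<longrightarrow>
                    (\<exists>!j. j < k \<and> pos t j = pos t i \<and> t < stop j))) \<and>
        (\<exists>i<k. pos T i = r) \<and>
        (\<forall>i<k. C' i = pos T i))"

definition dca_run ::
    "'v wgraph \<Rightarrow> nat \<Rightarrow> 'v config \<Rightarrow> 'v point list \<Rightarrow> 'v config list \<Rightarrow> bool" where
  "dca_run G k C \<sigma> cs \<longleftrightarrow>
     length cs = Suc (length \<sigma>) \<and> cs ! 0 = C \<and>
     (\<forall>t<length \<sigma>. dca_serve G k (\<sigma> ! t) (cs ! t) (cs ! Suc t))"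

end

theory Submission
  imports Defs
begin

text \<open>
  The tree is a comb: a spine with unit edges and, at every spine vertex, a tooth of length
  \<open>e = 1 / k\<close>. Server \<open>i \<ge> 1\<close> starts on the spine at \<open>i\<close> and server \<open>0\<close> starts at
  \<open>k + 1 + e / 2\<close>; the requests are the tips of the teeth \<open>k, k - 1, \<dots>, 2\<close>. At the request
  on tooth \<open>m\<close>, server \<open>m - 1\<close> and server \<open>0\<close> approach tooth \<open>m\<close> from the two sides. Server
  \<open>m - 1\<close> gets there slightly earlier, blocks server \<open>0\<close> and climbs to the tip, which leaves server
  \<open>0\<close> on the spine at \<open>m + e / 2\<close>, from where it leads the way to tooth \<open>m - 1\<close> and blocks
  everything behind it. So server \<open>0\<close> walks the whole spine, at cost 1 per request. Offline,
  server \<open>0\<close> moves to tooth \<open>k\<close> and every other server climbs its own tooth, at total cost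
  \<open>1 + e / 2 + k * e \<le> 3\<close>. The case \<open>k = 1\<close> uses the single request at tooth 1.
\<close>

section \<open>Graphs given by parent functions are trees\<close>

text \<open>When \<open>par v < v\<close> for all \<open>v > 0\<close>, the vertex \<open>n\<close>
  is a leaf of the graph on \<open>{..<Suc n}\<close>, so unique paths can be established by adding
  leaves one at a time.\<close>

definition rooted_graph :: "(nat \<Rightarrow> nat) \<Rightarrow> (nat set \<Rightarrow> real) \<Rightarrow> nat \<Rightarrow> nat wgraph" where
  "rooted_graph par w n = \<lparr>verts = {..<n}, edges = {{v, par v} | v. 0 < v \<and> v < n}, weight = w\<rparr>"

lemma simple_path_rev:
  assumes p: "simple_path G u xs v"
  shows "simple_path G v (rev xs) u"
proof -
  have "successively (\<lambda>a b. {b, a} \<in> edges G) xs"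
    using p by (simp add: simple_path_def insert_commute)
  then show ?thesis using p by (simp add: simple_path_def hd_rev last_rev)
qed

lemma simple_path_self: "simple_path G u xs u \<longleftrightarrow> u \<in> verts G \<and> xs = [u]"
proof
  assume p: "simple_path G u xs u"
  then obtain ys where "xs = u # ys" by (cases xs) (auto simp: simple_path_def)
  then show "u \<in> verts G \<and> xs = [u]" using p last_in_set[of ys]
    by (auto simp: simple_path_def split: if_splits)
qed (auto simp: simple_path_def)

lemma edge_rooted_graph:
  "{a, b} \<in> edges (rooted_graph par w n) \<longleftrightarrow>
     0 < a \<and> a < n \<and> b = par a \<or> 0 < b \<and> b < n \<and> a = par b"
proof -
  have "{a, b} \<in> edges (rooted_graph par w n) \<longleftrightarrow> (\<exists>v. {a, b} = {v, par v} \<and> 0 < v \<and> v < n)"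
    by (simp add: rooted_graph_def)
  also have "\<dots> \<longleftrightarrow> 0 < a \<and> a < n \<and> b = par a \<or> 0 < b \<and> b < n \<and> a = par b"
    unfolding doubleton_eq_iff by blast
  finally show ?thesis .
qed

context
  fixes par :: "nat \<Rightarrow> nat" and w :: "nat set \<Rightarrow> real" and n :: nat
  assumes par_less: "\<And>v. 0 < v \<Longrightarrow> par v < v" and n_pos: "0 < n"
begin

lemma edge_Suc_old:
  assumes "{a, b} \<in> edges (rooted_graph par w (Suc n))" "a \<noteq> n" "b \<noteq> n"
  shows "{a, b} \<in> edges (rooted_graph par w n)"
  using assms unfolding edge_rooted_graph by linarith

text \<open>The other orientation, \<open>n = par b\<close>, would force
  \<open>n < b < Suc n\<close>; so \<open>n\<close> is a leaf hanging from
  \<open>par n\<close>.\<close>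

lemma edge_Suc_new:
  assumes "{n, b} \<in> edges (rooted_graph par w (Suc n))"
  shows "b = par n"
  using assms par_less[of b] unfolding edge_rooted_graph by linarith

lemma simple_path_Suc_mono:
  "simple_path (rooted_graph par w n) u xs v \<Longrightarrow> simple_path (rooted_graph par w (Suc n)) u xs v"
  unfolding simple_path_def
  by (auto simp: edge_rooted_graph elim!: successively_mono) (auto simp: rooted_graph_def)

text \<open>A path with the leaf \<open>n\<close> in its interior would enter and leave it through
  \<open>par n\<close>, visiting \<open>par n\<close> twice.\<close>

lemma simple_path_Suc_old:
  assumes p: "simple_path (rooted_graph par w (Suc n)) u xs v" and uv: "u \<noteq> n" "v \<noteq> n"
  shows "simple_path (rooted_graph par w n) u xs v"
proof -
  have notin: "n \<notin> set xs"
  proof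
    assume "n \<in> set xs"
    then obtain ys zs where xs: "xs = ys @ n # zs" by (meson split_list)
    have "ys \<noteq> []" "zs \<noteq> []" using p uv unfolding simple_path_def xs by auto
    moreover from this have "{last ys, n} \<in> edges (rooted_graph par w (Suc n))"
      "{n, hd zs} \<in> edges (rooted_graph par w (Suc n))"
      using p unfolding simple_path_def xs
      by (auto simp: successively_append_iff successively_Cons)
    ultimately have "last ys = par n" "hd zs = par n" "last ys \<in> set ys" "hd zs \<in> set zs"
      using edge_Suc_new[of "last ys"] edge_Suc_new[of "hd zs"] last_in_set[of ys] hd_in_set[of zs]
      by (simp_all add: insert_commute)
    then show False using p unfolding simple_path_def xs by auto
  qed
  have "successively (\<lambda>a b. {a, b} \<in> edges (rooted_graph par w n)) xs"
    using p notin unfolding simple_path_def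
    by (auto intro: edge_Suc_old elim!: successively_mono)
  then show ?thesis using p notin unfolding simple_path_def
    by (auto simp: rooted_graph_def less_Suc_eq)
qed

lemma simple_path_Suc_new:
  assumes p: "simple_path (rooted_graph par w (Suc n)) n xs v" and v: "v \<noteq> n"
  shows "\<exists>ys. xs = n # ys \<and> simple_path (rooted_graph par w n) (par n) ys v"
proof -
  obtain ys where xs: "xs = n # ys" using p by (cases xs) (auto simp: simple_path_def)
  have ne: "ys \<noteq> []" using p v by (auto simp: simple_path_def xs)
  then have "hd ys = par n" using p edge_Suc_new[of "hd ys"]
    by (simp add: simple_path_def xs successively_Cons)
  then have "simple_path (rooted_graph par w (Suc n)) (par n) ys v"
    using p ne by (auto simp: simple_path_def xs successively_Cons)
  moreover have "par n \<noteq> n" using par_less[OF n_pos] by simp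
  ultimately show ?thesis using xs v simple_path_Suc_old by metis
qed

lemma simple_path_Suc_Cons:
  assumes "simple_path (rooted_graph par w n) (par n) ys v"
  shows "simple_path (rooted_graph par w (Suc n)) n (n # ys) v"
proof -
  have "{n, par n} \<in> edges (rooted_graph par w (Suc n))" using n_pos by (simp add: edge_rooted_graph)
  moreover have "n \<notin> set ys" using assms by (auto simp: simple_path_def rooted_graph_def)
  ultimately show ?thesis using simple_path_Suc_mono[OF assms]
    by (auto simp: simple_path_def successively_Cons) (auto simp: rooted_graph_def)
qed

text \<open>The new leaf \<open>n\<close> changes no path between old vertices; the paths from
  \<open>n\<close> are those from \<open>par n\<close> with \<open>n\<close> in front, and the paths
  to \<open>n\<close> are their reversals.\<close>

lemma ex1_simple_path_Suc:
  assumes IH: "\<forall>u<n. \<forall>v<n. \<exists>!xs. simple_path (rooted_graph par w n) u xs v"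
    and uv: "u < Suc n" "v < Suc n"
  shows "\<exists>!xs. simple_path (rooted_graph par w (Suc n)) u xs v"
proof -
  let ?P = "simple_path (rooted_graph par w n)" and ?Q = "simple_path (rooted_graph par w (Suc n))"
  have new: "\<exists>!xs. ?Q n xs y" if y: "y < n" for y
  proof -
    obtain ys where ys: "?P (par n) ys y" "\<And>zs. ?P (par n) zs y \<Longrightarrow> zs = ys"
      using IH y par_less[OF n_pos] by metis
    show ?thesis
    proof (rule ex1I)
      show "?Q n (n # ys) y" using simple_path_Suc_Cons ys by blast
      show "xs = n # ys" if "?Q n xs y" for xs
        using simple_path_Suc_new[OF that] ys y by blast
    qed
  qed
  consider "u < n" "v < n" | "u = n" "v = n" | "u = n" "v < n" | "u < n" "v = n"
    using uv by linarith
  then show ?thesis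
  proof cases
    case 1
    then obtain ys where ys: "?P u ys v" "\<And>zs. ?P u zs v \<Longrightarrow> zs = ys"
      using IH by metis
    show ?thesis
      using simple_path_Suc_mono[OF ys(1)] simple_path_Suc_old ys(2) 1 by blast
  next
    case 2
    then show ?thesis by (auto simp: simple_path_self rooted_graph_def)
  next
    case 3
    then show ?thesis using new by auto
  next
    case 4
    then obtain ys where ys: "?Q n ys u" "\<And>zs. ?Q n zs u \<Longrightarrow> zs = ys"
      using new by metis
    show ?thesis
    proof (rule ex1I)
      show "?Q u (rev ys) v" using simple_path_rev[OF ys(1)] 4 by simp
      show "xs = rev ys" if "?Q u xs v" for xs
        using ys(2)[of "rev xs"] simple_path_rev[OF that] 4 by (metis rev_rev_ident)
    qed
  qed
qed

end

lemma weighted_tree_rooted_graph: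
  assumes par: "\<And>v. 0 < v \<Longrightarrow> par v < v" and n: "0 < n" and w: "\<And>E. 0 < w E"
  shows "weighted_tree (rooted_graph par w n)"
proof -
  have "\<forall>u<n. \<forall>v<n. \<exists>!xs. simple_path (rooted_graph par w n) u xs v"
    using n
  proof (induction n)
    case (Suc n)
    show ?case
    proof (cases "n = 0")
      case True
      then show ?thesis by (auto simp: simple_path_self rooted_graph_def)
    next
      case False
      then show ?thesis using ex1_simple_path_Suc[OF par _ Suc.IH] by blast
    qed
  qed auto
  moreover have "\<exists>a b. {v, par v} = {a, b} \<and> a < n \<and> b < n \<and> a \<noteq> b" if "0 < v" "v < n" for v
    using par[of v] that by (intro exI[of _ v] exI[of _ "par v"]) auto
  ultimately show ?thesis
    using w n unfolding weighted_tree_def rooted_graph_def by auto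
qed

section \<open>The comb and its metric\<close>

text \<open>Both \<open>2 * i + 1\<close> and \<open>2 * i + 2\<close> get the parent
  \<open>2 * i\<close>: odd vertices hang as tips of teeth, even ones form the spine.\<close>

definition comb :: "nat \<Rightarrow> real \<Rightarrow> nat wgraph" where
  "comb N e = rooted_graph (\<lambda>v. 2 * ((v - 1) div 2))
     (\<lambda>E. if \<exists>i. E = {2 * i, 2 * i + 1} then e else 1) (2 * N + 2)"

definition comb_coords :: "nat \<Rightarrow> real \<Rightarrow> (real \<times> real) set" where
  "comb_coords N e = {(x, y). 0 \<le> x \<and> x \<le> real N \<and> 0 \<le> y \<and> y \<le> e \<and> (y = 0 \<or> x \<in> \<nat>)}"

text \<open>In the coordinates \<open>(x, y)\<close> of a comb, \<open>x\<close> is the position along the spine and \<open>y\<close> the height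
  on the tooth at \<open>x\<close>. The spine vertex \<open>(i, 0)\<close> is numbered \<open>2 * i\<close> and the tip \<open>(i, e)\<close> of its
  tooth is numbered \<open>2 * i + 1\<close>.\<close>

definition comb_point :: "real \<Rightarrow> real \<times> real \<Rightarrow> nat point" where
  "comb_point e a v =
     (if even v then max 0 (1 - \<bar>fst a - real (v div 2)\<bar>) - (if fst a = real (v div 2) then snd a / e else 0)
      else if fst a = real (v div 2) then snd a / e else 0)"

definition comb_dist :: "real \<times> real \<Rightarrow> real \<times> real \<Rightarrow> real" where
  "comb_dist a b =
     (if fst a = fst b then \<bar>snd a - snd b\<bar> else snd a + \<bar>fst a - fst b\<bar> + snd b)"

lemma weighted_tree_comb: "0 < e \<Longrightarrow> weighted_tree (comb N e)"
  unfolding comb_def by (rule weighted_tree_rooted_graph) auto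

lemma comb_edge_cases:
  assumes "E \<in> edges (comb N e)"
  obtains i where "i \<le> N" "E = {2 * i, 2 * i + 1}" | i where "i < N" "E = {2 * i, 2 * i + 2}"
proof -
  obtain v where v: "E = {v, 2 * ((v - 1) div 2)}" "0 < v" "v < 2 * N + 2"
    using assms by (auto simp: comb_def rooted_graph_def)
  show thesis
  proof (cases "odd v")
    case True
    then obtain i where "v = 2 * i + 1" by (rule oddE)
    then show ?thesis using v that(1)[of i] by (simp add: insert_commute)
  next
    case False
    then obtain j where "v = 2 * j" by auto
    then obtain i where "v = 2 * i + 2" using v(2) by (cases j) auto
    then show ?thesis using v that(2)[of i] by (simp add: insert_commute)
  qed
qed

lemma tooth_edge: "i \<le> N \<Longrightarrow> {2 * i, 2 * i + 1} \<in> edges (comb N e)"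
  unfolding comb_def edge_rooted_graph by simp

lemma spine_edge: "i < N \<Longrightarrow> {2 * i, 2 * i + 2} \<in> edges (comb N e)"
  unfolding comb_def edge_rooted_graph by simp

lemma weight_tooth: "weight (comb N e) {2 * i, 2 * i + 1} = e"
  unfolding comb_def rooted_graph_def by auto

lemma weight_spine: "weight (comb N e) {2 * i, 2 * i + 2} = 1"
proof -
  have "{2 * i, 2 * i + 2} \<noteq> {2 * j, 2 * j + 1}" for j :: nat
    unfolding doubleton_eq_iff by presburger
  then show ?thesis unfolding comb_def rooted_graph_def by auto
qed

section \<open>Points of the comb in coordinates\<close>

definition edge_point :: "'v \<Rightarrow> 'v \<Rightarrow> real \<Rightarrow> 'v point" where
  "edge_point u v s = (\<lambda>x. if x = u then 1 - s else if x = v then s else 0)"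

lemma cell_points_pair:
  assumes "u \<noteq> v"
  shows "p \<in> cell_points {u, v} \<longleftrightarrow> (\<exists>s. 0 \<le> s \<and> s \<le> 1 \<and> p = edge_point u v s)"
proof
  assume p: "p \<in> cell_points {u, v}"
  then have "p u + p v = 1" "0 \<le> p u" "0 \<le> p v" using assms by (auto simp: cell_points_def)
  moreover from this have "p = edge_point u v (p v)"
    using p by (auto simp: cell_points_def edge_point_def fun_eq_iff)
  ultimately show "\<exists>s. 0 \<le> s \<and> s \<le> 1 \<and> p = edge_point u v s"
    by (intro exI[of _ "p v"]) auto
qed (use assms in \<open>auto simp: cell_points_def edge_point_def\<close>)

lemma edge_point_in_cell: "u \<noteq> v \<Longrightarrow> 0 \<le> s \<Longrightarrow> s \<le> 1 \<Longrightarrow> edge_point u v s \<in> cell_points {u, v}"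
  by (auto simp: cell_points_pair)

lemma cell_points_single: "p \<in> cell_points {u} \<longleftrightarrow> p = (\<lambda>x. if x = u then 1 else 0)"
proof
  assume "p \<in> cell_points {u}"
  then have "p u = 1" "p x = 0" if "x \<noteq> u" for x using that by (auto simp: cell_points_def)
  then show "p = (\<lambda>x. if x = u then 1 else 0)"
    using \<open>p \<in> cell_points {u}\<close> by (auto simp: cell_points_def)
qed (auto simp: cell_points_def)

lemma segment_length_edge_point:
  assumes "u \<noteq> v"
  shows "segment_length G {u, v} (edge_point u v s) (edge_point u v s') = weight G {u, v} * \<bar>s - s'\<bar>"
proof -
  have "(\<Sum>x\<in>{u, v}. \<bar>edge_point u v s x - edge_point u v s' x\<bar>) = 2 * \<bar>s - s'\<bar>"
    using assms by (auto simp: edge_point_def)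
  then show ?thesis by (simp add: segment_length_def)
qed

text \<open>The term \<open>max 0 (1 - ...)\<close> in \<open>comb_point\<close> is the hat function
  of a spine vertex. Between \<open>i\<close> and \<open>i + 1\<close> the hats of all other spine
  vertices vanish, and those of the two ends are the barycentric coordinates \<open>1 - s\<close>
  and \<open>s\<close>.\<close>

lemma comb_point_spine:
  assumes "0 \<le> s" "s \<le> 1"
  shows "comb_point e (real i + s, 0) = edge_point (2 * i) (2 * i + 2) s"
proof
  fix v
  consider "v = 2 * i" | "v = 2 * i + 2" | "odd v" | j where "v = 2 * j" "j < i" | j where "v = 2 * j" "i + 1 < j"
  proof (cases "odd v")
    case False
    then obtain j where "v = 2 * j" by auto
    then show ?thesis using that by (cases "j < i"; cases "j = i"; cases "j = i + 1") auto
  qed (use that in auto)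
  then show "comb_point e (real i + s, 0) v = edge_point (2 * i) (2 * i + 2) s v"
  proof cases
    case (4 j)
    then have "real j + 1 \<le> real i" by linarith
    then show ?thesis using assms 4 by (simp add: comb_point_def edge_point_def)
  next
    case (5 j)
    then have "real i + 2 \<le> real j" by linarith
    then show ?thesis using assms 5 by (simp add: comb_point_def edge_point_def)
  next
    case 3
    then obtain j where "v = 2 * j + 1" by (rule oddE)
    moreover have "2 * j + 1 \<noteq> 2 * i" "2 * j + 1 \<noteq> 2 * i + 2" by presburger+
    ultimately show ?thesis by (auto simp: comb_point_def edge_point_def)
  qed (use assms in \<open>auto simp: comb_point_def edge_point_def\<close>)
qed

text \<open>At position \<open>i\<close> the hat of vertex \<open>2 * i\<close> is 1 and all others
  vanish; the share \<open>e * s / e = s\<close> is moved from the foot of the tooth to its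
  tip.\<close>

lemma comb_point_tooth:
  assumes "e \<noteq> 0"
  shows "comb_point e (real i, e * s) = edge_point (2 * i) (2 * i + 1) s"
proof
  fix v :: nat
  have "max 0 (1 - \<bar>real i - real j\<bar>) = (if j = i then 1 else 0)" for j
    by (cases i j rule: linorder_cases) auto
  moreover obtain j where "v = 2 * j \<or> v = 2 * j + 1" by (metis evenE oddE)
  moreover have "2 * j + 1 \<noteq> 2 * i" "2 * j \<noteq> 2 * i + 1" by presburger+
  ultimately show "comb_point e (real i, e * s) v = edge_point (2 * i) (2 * i + 1) s v"
    using assms by (elim disjE) (simp_all add: comb_point_def edge_point_def)
qed

lemma comb_coords_cases:
  assumes "a \<in> comb_coords N e" "0 < e" "0 < N"
  obtains i s where "i < N" "0 \<le> s" "s \<le> 1" "a = (real i + s, 0)"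
  | i s where "i \<le> N" "0 \<le> s" "s \<le> 1" "a = (real i, e * s)"
proof -
  obtain x y where a: "a = (x, y)" by (cases a)
  show thesis
  proof (cases "y = 0")
    case True
    show ?thesis
    proof (cases "x = real N")
      case True
      \<comment> \<open>No spine edge starts at \<open>N\<close>; the right end of the spine is the
        end \<open>s = 1\<close> of the last edge.\<close>
      then show ?thesis using that(1)[of "N - 1" 1] \<open>y = 0\<close> a assms(3) by (simp add: of_nat_diff)
    next
      case False
      then have x: "0 \<le> x" "x < real N" using assms a by (auto simp: comb_coords_def)
      define i where "i = nat \<lfloor>x\<rfloor>"
      have "real i \<le> x" "x \<le> real i + 1" "i < N"
        using x unfolding i_def by linarith+
      then show ?thesis using that(1)[of i "x - real i"] \<open>y = 0\<close> a by simp
    qed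
  next
    case False
    then obtain i where "x = real i" using assms a by (auto simp: comb_coords_def Nats_def)
    then show ?thesis using that(2)[of i "y / e"] assms a by (auto simp: comb_coords_def)
  qed
qed

lemma spine_coords: "i < N \<Longrightarrow> 0 \<le> s \<Longrightarrow> s \<le> 1 \<Longrightarrow> 0 < e \<Longrightarrow> (real i + s, 0) \<in> comb_coords N e"
  by (auto simp: comb_coords_def)

lemma tooth_coords: "i \<le> N \<Longrightarrow> 0 \<le> s \<Longrightarrow> s \<le> 1 \<Longrightarrow> 0 < e \<Longrightarrow> (real i, e * s) \<in> comb_coords N e"
  by (auto simp: comb_coords_def mult_left_le)

text \<open>Translates one segment of a route into coordinates together with its length, as needed
  for an induction over routes.\<close>

lemma comb_edge_point:
  assumes "E \<in> edges (comb N e)" "p \<in> cell_points E" "q \<in> cell_points E" "0 < e"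
  shows "\<exists>a\<in>comb_coords N e. \<exists>b\<in>comb_coords N e. p = comb_point e a \<and> q = comb_point e b \<and>
           segment_length (comb N e) E p q = comb_dist a b"
  using assms(1)
proof (cases rule: comb_edge_cases)
  case (1 i)
  then obtain s t where "0 \<le> s" "s \<le> 1" "p = edge_point (2 * i) (2 * i + 1) s"
    "0 \<le> t" "t \<le> 1" "q = edge_point (2 * i) (2 * i + 1) t"
    using assms(2,3) by (auto simp: cell_points_pair)
  moreover have "segment_length (comb N e) E (edge_point (2 * i) (2 * i + 1) s) (edge_point (2 * i) (2 * i + 1) t)
      = e * \<bar>s - t\<bar>"
    using segment_length_edge_point[of "2 * i" "2 * i + 1"] weight_tooth[of N e i] 1 by simp
  moreover have "\<bar>e * s - e * t\<bar> = e * \<bar>s - t\<bar>"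
    using assms(4) by (simp add: abs_mult flip: right_diff_distrib)
  ultimately show ?thesis
    using 1 assms(4) comb_point_tooth[of e i]
    by (intro bexI[OF _ tooth_coords[of i N s]] bexI[OF _ tooth_coords[of i N t]]) (auto simp: comb_dist_def)
next
  case (2 i)
  then obtain s t where "0 \<le> s" "s \<le> 1" "p = edge_point (2 * i) (2 * i + 2) s"
    "0 \<le> t" "t \<le> 1" "q = edge_point (2 * i) (2 * i + 2) t"
    using assms(2,3) by (auto simp: cell_points_pair)
  moreover have "segment_length (comb N e) E (edge_point (2 * i) (2 * i + 2) s) (edge_point (2 * i) (2 * i + 2) t)
      = \<bar>s - t\<bar>"
    using segment_length_edge_point[of "2 * i" "2 * i + 2"] weight_spine[of N e i] 2 by simp
  ultimately show ?thesis
    using 2 assms(4) comb_point_spine[of _ e i]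
    by (intro bexI[OF _ spine_coords[of i N s]] bexI[OF _ spine_coords[of i N t]]) (auto simp: comb_dist_def)
qed

lemma tree_points_comb:
  assumes e: "0 < e" and N: "0 < N"
  shows "tree_points (comb N e) = comb_point e ` comb_coords N e"
proof (intro subset_antisym subsetI)
  fix p assume p: "p \<in> tree_points (comb N e)"
  have "\<exists>E\<in>edges (comb N e). p \<in> cell_points E"
  proof (cases "\<exists>E\<in>edges (comb N e). p \<in> cell_points E")
    case False
    then obtain v where "v \<in> verts (comb N e)" and v: "p = (\<lambda>x. if x = v then 1 else 0)"
      using p unfolding tree_points_def Un_iff UN_iff cell_points_single by blast
    then have "v < 2 * N + 2" by (simp add: comb_def rooted_graph_def)
    moreover obtain j where j: "v = 2 * j \<or> v = 2 * j + 1" by (metis evenE oddE)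
    ultimately have "j \<le> N" by linarith
    \<comment> \<open>Every vertex is an end of a tooth, the foot if even and the tip if odd, so
      single-vertex cells add no points.\<close>
    have "p = edge_point (2 * j) (2 * j + 1) (if v = 2 * j then 0 else 1)"
      using j by (auto simp: v edge_point_def fun_eq_iff)
    then have "p \<in> cell_points {2 * j, 2 * j + 1}"
      by (subst cell_points_pair) (auto intro!: exI[of _ "if v = 2 * j then 0 else 1"])
    then show ?thesis using tooth_edge \<open>j \<le> N\<close> by blast
  qed
  then obtain E where "E \<in> edges (comb N e)" "p \<in> cell_points E" by blast
  from comb_edge_point[OF this this(2) e] show "p \<in> comb_point e ` comb_coords N e" by blast
next
  fix p assume "p \<in> comb_point e ` comb_coords N e"
  then obtain a where a: "a \<in> comb_coords N e" "p = comb_point e a" by auto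
  have "\<exists>E\<in>edges (comb N e). p \<in> cell_points E"
    using a(1) e N
  proof (cases rule: comb_coords_cases)
    case (1 i s)
    then have "p \<in> cell_points {2 * i, 2 * i + 2}"
      using a(2) comb_point_spine by (auto simp: cell_points_pair)
    then show ?thesis using 1 spine_edge by blast
  next
    case (2 i s)
    then have "p \<in> cell_points {2 * i, 2 * i + 1}"
      using a(2) comb_point_tooth e by (auto simp: cell_points_pair)
    then show ?thesis using 2 tooth_edge by blast
  qed
  then show "p \<in> tree_points (comb N e)" by (auto simp: tree_points_def)
qed

text \<open>A point off the spine shows its height at an odd vertex. For spine points, with
  \<open>i\<close> the floor of the position of \<open>a\<close>, the hat at \<open>i\<close> gives
  the distance from \<open>i\<close>, and the hat at \<open>i + 1\<close> excludes the mirror image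
  to the left of \<open>i\<close>.\<close>

lemma comb_point_inj:
  assumes e: "0 < e" and a: "a \<in> comb_coords N e" and b: "b \<in> comb_coords N e"
    and eq: "comb_point e a = comb_point e b"
  shows "a = b"
proof -
  have tooth: "a = b" if y: "snd a \<noteq> 0" and a: "a \<in> comb_coords N e" and b: "b \<in> comb_coords N e"
    and eq: "comb_point e a = comb_point e b" for a b
  proof -
    obtain i where i: "fst a = real i" using a y by (auto simp: comb_coords_def Nats_def)
    have "comb_point e b (2 * i + 1) = snd a / e"
      unfolding eq[symmetric] using i by (simp add: comb_point_def)
    then show ?thesis using i y e by (auto simp: comb_point_def prod_eq_iff split: if_splits)
  qed
  show ?thesis
  proof (cases "snd a = 0 \<and> snd b = 0")
    case True
    define i where "i = nat \<lfloor>fst a\<rfloor>"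
    have "0 \<le> fst a" using a by (auto simp: comb_coords_def)
    then have x: "real i \<le> fst a" "fst a < real i + 1" unfolding i_def by linarith+
    have hat: "max 0 (1 - \<bar>fst a - real j\<bar>) = max 0 (1 - \<bar>fst b - real j\<bar>)" for j
    proof -
      have "comb_point e c (2 * j) = max 0 (1 - \<bar>fst c - real j\<bar>)" if "snd c = 0" for c
        using that by (simp add: comb_point_def)
      then show ?thesis using True fun_cong[OF eq, of "2 * j"] by simp
    qed
    have "\<bar>fst b - real i\<bar> = fst a - real i"
      using hat[of i] x by (simp add: max_def split: if_splits)
    moreover have "max 0 (1 - \<bar>fst b - (real i + 1)\<bar>) = fst a - real i"
      using hat[of "i + 1"] x by (simp add: add.commute)
    ultimately have "fst a = fst b" using x by linarith
    then show ?thesis using True by (simp add: prod_eq_iff)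
  next
    case False
    then show ?thesis using tooth[OF _ a b eq] tooth[OF _ b a eq[symmetric]] by metis
  qed
qed

section \<open>The shortest-path distance of the comb\<close>

lemma segment_length_commute: "segment_length G E p q = segment_length G E q p"
  by (simp add: segment_length_def abs_minus_commute)

lemma route_trans: "route G p q L \<Longrightarrow> route G q r M \<Longrightarrow> route G p r (L + M)"
  by (induction rule: route.induct) (auto simp: add.assoc intro: route.step)

lemma route_segment:
  assumes "E \<in> edges G" "p \<in> cell_points E" "q \<in> cell_points E"
  shows "route G p q (segment_length G E p q)"
  using route.step[OF assms route.stay] assms by (force simp: tree_points_def)

lemma route_sym: "route G p q L \<Longrightarrow> route G q p L"
proof (induction rule: route.induct)
  case (step E p q r L)
  then show ?case
    using route_trans[OF step.IH route_segment[of E G q p]] segment_length_commute[of G E p q]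
    by (simp add: add.commute)
qed (rule route.stay)

lemma comb_dist_triangle:
  assumes "a \<in> comb_coords N e" "b \<in> comb_coords N e" "c \<in> comb_coords N e"
  shows "comb_dist a c \<le> comb_dist a b + comb_dist b c"
  using assms by (auto simp: comb_coords_def comb_dist_def)

lemma comb_dist_nonneg: "a \<in> comb_coords N e \<Longrightarrow> b \<in> comb_coords N e \<Longrightarrow> 0 \<le> comb_dist a b"
  by (auto simp: comb_coords_def comb_dist_def)

text \<open>Each segment costs the coordinate distance of its ends, and the triangle inequality adds
  these up. Injectivity of \<open>comb_point\<close> makes the coordinates of a shared end
  unique.\<close>

lemma comb_dist_le_route:
  assumes "route (comb N e) p q L" "0 < e" "a \<in> comb_coords N e" "b \<in> comb_coords N e"
    "p = comb_point e a" "q = comb_point e b"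
  shows "comb_dist a b \<le> L"
  using assms(1,3,5,6)
proof (induction arbitrary: a rule: route.induct)
  case (stay p)
  then have "a = b" using comb_point_inj assms(2,4) by metis
  then show ?case by (simp add: comb_dist_def)
next
  case (step E p q r L)
  obtain a' c where ac: "a' \<in> comb_coords N e" "c \<in> comb_coords N e" "p = comb_point e a'" "q = comb_point e c"
    "segment_length (comb N e) E p q = comb_dist a' c"
    using comb_edge_point[OF step.hyps(1-3) assms(2)] by blast
  have "a' = a" using comb_point_inj[OF assms(2) ac(1) step.prems(1)] ac(3) step.prems(2) by simp
  moreover have "comb_dist c b \<le> L" using step.IH ac(2,4) step.prems by blast
  ultimately show ?case using comb_dist_triangle[OF step.prems(1) ac(2) assms(4)] ac(5) by simp
qed

lemma route_tooth:
  assumes "0 < e" "i \<le> N" "0 \<le> y" "y \<le> e" "0 \<le> y'" "y' \<le> e"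
  shows "route (comb N e) (comb_point e (real i, y)) (comb_point e (real i, y')) \<bar>y - y'\<bar>"
proof -
  let ?p = "edge_point (2 * i) (2 * i + 1)"
  have p: "comb_point e (real i, y) = ?p (y / e)" "comb_point e (real i, y') = ?p (y' / e)"
    using comb_point_tooth[of e i "y / e"] comb_point_tooth[of e i "y' / e"] assms by simp_all
  have cells: "?p (y / e) \<in> cell_points {2 * i, 2 * i + 1}" "?p (y' / e) \<in> cell_points {2 * i, 2 * i + 1}"
    by (rule edge_point_in_cell; use assms in simp)+
  have "segment_length (comb N e) {2 * i, 2 * i + 1} (?p (y / e)) (?p (y' / e)) = e * \<bar>y / e - y' / e\<bar>"
    using segment_length_edge_point[of "2 * i" "2 * i + 1"] weight_tooth[of N e i] by simp
  also have "\<dots> = \<bar>y - y'\<bar>"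
    using assms(1) by (simp add: abs_divide flip: diff_divide_distrib)
  finally show ?thesis
    using route_segment[OF tooth_edge[OF assms(2)] cells, of e] p by simp
qed

lemma route_spine_cell:
  assumes "i < N" "real i \<le> x" "x \<le> real i + 1" "real i \<le> x'" "x' \<le> real i + 1"
  shows "route (comb N e) (comb_point e (x, 0)) (comb_point e (x', 0)) \<bar>x - x'\<bar>"
proof -
  let ?p = "edge_point (2 * i) (2 * i + 2)"
  have p: "comb_point e (x, 0) = ?p (x - real i)" "comb_point e (x', 0) = ?p (x' - real i)"
    using comb_point_spine[of "x - real i" e i] comb_point_spine[of "x' - real i" e i] assms by simp_all
  have cells: "?p (x - real i) \<in> cell_points {2 * i, 2 * i + 2}" "?p (x' - real i) \<in> cell_points {2 * i, 2 * i + 2}"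
    by (rule edge_point_in_cell; use assms in simp)+
  have "segment_length (comb N e) {2 * i, 2 * i + 2} (?p (x - real i)) (?p (x' - real i)) = \<bar>x - x'\<bar>"
    using segment_length_edge_point[of "2 * i" "2 * i + 2"] weight_spine[of N e i] by simp
  then show ?thesis
    using route_segment[OF spine_edge[OF assms(1)] cells, of e] p by simp
qed

lemma route_spine:
  assumes e: "0 < e" and N: "0 < N" and x: "0 \<le> x" "x \<le> real N" "0 \<le> x'" "x' \<le> real N"
  shows "route (comb N e) (comb_point e (x, 0)) (comb_point e (x', 0)) \<bar>x - x'\<bar>"
proof -
  \<comment> \<open>Induction on the stretch of spine up to \<open>n\<close>; a route passing
    \<open>n\<close> is cut there, and its last piece lies in one edge. Leftward routes are
    reversals.\<close>
  have incr: "route (comb N e) (comb_point e (x, 0)) (comb_point e (x', 0)) (x' - x)"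
    if "n \<le> N" "0 \<le> x" "x \<le> x'" "x' \<le> real n" for n x x'
    using that
  proof (induction n arbitrary: x x')
    case 0
    then have "x = 0" "x' = 0" by simp_all
    then show ?case using route_spine_cell[of 0 N 0 0 e] N by simp
  next
    case (Suc n)
    consider "x' \<le> real n" | "real n \<le> x" | "x < real n" "real n < x'" by linarith
    then show ?case
    proof cases
      case 1
      then show ?thesis using Suc by simp
    next
      case 2
      then show ?thesis using Suc.prems route_spine_cell[of n N x x' e] by simp
    next
      case 3
      have "route (comb N e) (comb_point e (x, 0)) (comb_point e (real n, 0)) (real n - x)"
        using Suc 3 by simp
      moreover have "route (comb N e) (comb_point e (real n, 0)) (comb_point e (x', 0)) (x' - real n)"
        using route_spine_cell[of n N "real n" x' e] Suc.prems 3 by simp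
      ultimately show ?thesis using route_trans by fastforce
    qed
  qed
  show ?thesis
  proof (cases "x \<le> x'")
    case True
    then show ?thesis using incr[of N x x'] x by simp
  next
    case False
    then show ?thesis using route_sym[OF incr[of N x' x]] x by simp
  qed
qed

lemma route_comb_dist:
  assumes e: "0 < e" and N: "0 < N" and a: "a \<in> comb_coords N e" and b: "b \<in> comb_coords N e"
  shows "route (comb N e) (comb_point e a) (comb_point e b) (comb_dist a b)"
proof -
  obtain x y x' y' where ab: "a = (x, y)" "b = (x', y')" by (cases a, cases b)
  have tooth: "route (comb N e) (comb_point e (x, y)) (comb_point e (x, y')) \<bar>y - y'\<bar>"
    if "(x, y) \<in> comb_coords N e" "(x, y') \<in> comb_coords N e" for x y y'
  proof (cases "y = 0 \<and> y' = 0")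
    case True
    then show ?thesis using route_spine[OF e N, of x x] that by (simp add: comb_coords_def)
  next
    case False
    then have "x \<in> \<nat>" using that by (auto simp: comb_coords_def)
    then obtain i where "x = real i" by (auto simp: Nats_def)
    then show ?thesis using route_tooth[OF e, of i N y y'] that by (simp add: comb_coords_def)
  qed
  show ?thesis
  proof (cases "x = x'")
    case True
    then show ?thesis using tooth[of x y y'] a b ab by (simp add: comb_dist_def)
  next
    case False
    have z: "(x, 0) \<in> comb_coords N e" "(x', 0) \<in> comb_coords N e"
      using a b ab e by (auto simp: comb_coords_def)
    \<comment> \<open>Down the first tooth, along the spine, up the second tooth.\<close>
    have "route (comb N e) (comb_point e a) (comb_point e b) (\<bar>y - 0\<bar> + (\<bar>x - x'\<bar> + \<bar>0 - y'\<bar>))"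
      using route_trans[OF tooth[of x y 0] route_trans[OF route_spine[OF e N, of x x'] tooth[of x' 0 y']]]
        a b ab z by (simp add: comb_coords_def)
    moreover have "0 \<le> y" "0 \<le> y'" using a b ab by (auto simp: comb_coords_def)
    ultimately show ?thesis using False ab by (simp add: comb_dist_def add.assoc)
  qed
qed

theorem tree_dist_comb:
  assumes "0 < e" "0 < N" "a \<in> comb_coords N e" "b \<in> comb_coords N e"
  shows "tree_dist (comb N e) (comb_point e a) (comb_point e b) = comb_dist a b"
  unfolding tree_dist_def
proof (rule cInf_eq_minimum)
  show "comb_dist a b \<in> {L. route (comb N e) (comb_point e a) (comb_point e b) L}"
    using route_comb_dist[OF assms] by simp
qed (use comb_dist_le_route assms in blast)

text \<open>On a comb, the distance from the start singles out a point of a geodesic. Hence in a DCA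
  step the position of a server is determined by how long it has moved.\<close>

lemma comb_geodesic_unique:
  assumes "a \<in> comb_coords N e" "b \<in> comb_coords N e" "b' \<in> comb_coords N e" "c \<in> comb_coords N e"
    and "comb_dist a b + comb_dist b c = comb_dist a c"
    and "comb_dist a b' + comb_dist b' c = comb_dist a c"
    and "comb_dist a b = comb_dist a b'"
  shows "b = b'"
proof -
  have "0 \<le> snd a" "0 \<le> snd b" "0 \<le> snd b'" "0 \<le> snd c"
    using assms(1-4) by (auto simp: comb_coords_def)
  then show ?thesis
    using assms(5-7) unfolding comb_dist_def prod_eq_iff
    by (smt (verit))
qed

section \<open>Runs of DCA on a comb\<close>

definition comb_between :: "real \<times> real \<Rightarrow> real \<times> real \<Rightarrow> real \<times> real \<Rightarrow> bool" where
  "comb_between a b c \<longleftrightarrow> comb_dist a b + comb_dist b c = comb_dist a c"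

lemma tree_path_comb:
  assumes "0 < e" "0 < N" "a \<in> comb_coords N e" "b \<in> comb_coords N e" "c \<in> comb_coords N e"
  shows "comb_point e b \<in> tree_path (comb N e) (comb_point e a) (comb_point e c) \<longleftrightarrow> comb_between a b c"
  using assms by (auto simp: tree_path_def comb_between_def tree_dist_comb tree_points_comb)

text \<open>For servers at distinct points, \<open>P j \<noteq> P i\<close> is just
  \<open>j \<noteq> i\<close>, and blocking can be read off the coordinates.\<close>

lemma blocked_comb:
  assumes "0 < e" "0 < N" "r \<in> comb_coords N e" "\<And>j. j < k \<Longrightarrow> B j \<in> comb_coords N e"
    "\<And>j. j < k \<Longrightarrow> P j = comb_point e (B j)" "inj_on B {..<k}" "i < k"
  shows "blocked (comb N e) k (comb_point e r) P i \<longleftrightarrow> (\<exists>j<k. j \<noteq> i \<and> comb_between (B i) (B j) r)"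
proof -
  have "P j \<noteq> P i \<longleftrightarrow> j \<noteq> i" if "j < k" for j
    using assms comb_point_inj[of e "B j" N "B i"] inj_onD[of B "{..<k}" j i] that by auto
  moreover have "P j \<in> tree_path (comb N e) (P i) (comb_point e r) \<longleftrightarrow> comb_between (B i) (B j) r" if "j < k" for j
    using assms tree_path_comb that by auto
  ultimately show ?thesis unfolding blocked_def by blast
qed

text \<open>Two runs that first disagree at time \<open>s\<close> have the same configuration at that time, and
  this configuration decides which servers go on.\<close>

lemma dca_serve_comb:
  fixes A :: "real \<Rightarrow> nat \<Rightarrow> real \<times> real"
  assumes e: "0 < e" and N: "0 < N" and r: "r \<in> comb_coords N e"
    and T: "0 \<le> T" and stop: "\<And>i. i < k \<Longrightarrow> 0 \<le> stop i \<and> stop i \<le> T"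
    and A: "\<And>i t. i < k \<Longrightarrow> 0 \<le> t \<Longrightarrow> t \<le> T \<Longrightarrow> A t i \<in> comb_coords N e"
    and path: "\<And>i t. i < k \<Longrightarrow> 0 \<le> t \<Longrightarrow> t \<le> T \<Longrightarrow> comb_between (A 0 i) (A t i) r"
    and speed: "\<And>i t. i < k \<Longrightarrow> 0 \<le> t \<Longrightarrow> t \<le> T \<Longrightarrow> comb_dist (A 0 i) (A t i) = min t (stop i)"
    and inj: "\<And>t. 0 \<le> t \<Longrightarrow> t < T \<Longrightarrow> inj_on (A t) {..<k}"
    and not_r: "\<And>i t. i < k \<Longrightarrow> 0 \<le> t \<Longrightarrow> t < T \<Longrightarrow> A t i \<noteq> r"
    and bl: "\<And>i t. i < k \<Longrightarrow> 0 \<le> t \<Longrightarrow> t < T \<Longrightarrow>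
               (\<exists>j<k. j \<noteq> i \<and> comb_between (A t i) (A t j) r) \<longleftrightarrow> stop i \<le> t"
    and hit: "\<exists>i<k. A T i = r"
    and C: "\<And>i. i < k \<Longrightarrow> C i = comb_point e (A 0 i)"
  shows "dca_serve (comb N e) k (comb_point e r) C C' \<longleftrightarrow> (\<forall>i<k. C' i = comb_point e (A T i))"
proof
  let ?G = "comb N e"
  note blocked = blocked_comb[OF e N r]
  have A0: "A 0 i \<in> comb_coords N e" if "i < k" for i using A[of i 0] T that by simp
  show "\<forall>i<k. C' i = comb_point e (A T i)" if "dca_serve ?G k (comb_point e r) C C'"
  proof -
    obtain T' :: real and stop' :: "nat \<Rightarrow> real" and pos where T': "0 \<le> T'"
      and stop': "\<forall>i<k. 0 \<le> stop' i \<and> stop' i \<le> T'"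
      and pos: "\<forall>i<k. \<forall>t\<in>{0..T'}. pos t i \<in> tree_path ?G (C i) (comb_point e r) \<and>
                            tree_dist ?G (C i) (pos t i) = min t (stop' i)"
      and move: "\<forall>t\<in>{0..<T'}.
           (\<forall>i<k. pos t i \<noteq> comb_point e r) \<and>
           (\<forall>i<k. t < stop' i \<longrightarrow> \<not> blocked ?G k (comb_point e r) (pos t) i) \<and>
           (\<forall>i<k. \<not> blocked ?G k (comb_point e r) (pos t) i \<longrightarrow>
                    (\<exists>!j. j < k \<and> pos t j = pos t i \<and> t < stop' j))"
      and hit': "\<exists>i<k. pos T' i = comb_point e r" and C': "\<forall>i<k. C' i = pos T' i"
      using \<open>dca_serve ?G k (comb_point e r) C C'\<close> unfolding dca_serve_def by blast
    \<comment> \<open>Both positions lie on the geodesic to \<open>r\<close> at the same distance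
      from the start.\<close>
    have agree: "pos t i = comb_point e (A t i)"
      if "i < k" "0 \<le> t" "t \<le> T" "t \<le> T'" "min t (stop i) = min t (stop' i)" for i t
    proof -
      have p: "pos t i \<in> tree_path ?G (C i) (comb_point e r)" "tree_dist ?G (C i) (pos t i) = min t (stop' i)"
        using pos that by auto
      then obtain b where b: "b \<in> comb_coords N e" "pos t i = comb_point e b"
        using tree_points_comb[OF e N] by (auto simp: tree_path_def)
      have "comb_between (A 0 i) b r"
        using p(1) tree_path_comb[OF e N A0 b(1) r] b(2) C that by simp
      moreover have "comb_dist (A 0 i) b = min t (stop' i)"
        using p(2) tree_dist_comb[OF e N A0 b(1)] b(2) C that by simp
      ultimately have "b = A t i"
        using comb_geodesic_unique[OF A0 b(1) A r, of i i t] path[of i t] speed[of i t] that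
        by (simp add: comb_between_def)
      then show ?thesis using b(2) by simp
    qed
    \<comment> \<open>If the configurations agree at the earlier of the two end times, the run
      ending there has a server at \<open>r\<close>, while the longer run must have none there
      yet.\<close>
    have reach: "T' = T" if "\<And>i. i < k \<Longrightarrow> min (min T T') (stop i) = min (min T T') (stop' i)"
    proof (rule ccontr)
      assume "T' \<noteq> T"
      have pos_A: "pos (min T T') i = comb_point e (A (min T T') i)" if "i < k" for i
        by (rule agree) (use that T T' \<open>\<And>i. i < k \<Longrightarrow> min (min T T') (stop i) = min (min T T') (stop' i)\<close> in auto)
      show False
      proof (cases "T < T'")
        case True
        moreover obtain i where "i < k" "A T i = r" using hit by blast
        ultimately have "pos T i = comb_point e r" using pos_A[of i] by (simp add: min_def)
        then show False using move T True \<open>i < k\<close> by simp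
      next
        case False
        then have "T' < T" using \<open>T' \<noteq> T\<close> by simp
        then obtain i where "i < k" "comb_point e (A T' i) = comb_point e r"
          using pos_A hit' by (auto simp: min_def)
        then show False using comb_point_inj[OF e A r, of i T'] not_r \<open>T' < T\<close> T' by simp
      qed
    qed
    have same: "stop i = stop' i" if "i < k" for i
    proof (rule ccontr)
      assume "stop i \<noteq> stop' i"
      let ?bad = "{i. i < k \<and> stop i \<noteq> stop' i}"
      \<comment> \<open>\<open>i0\<close> is a server with differing stopping times whose earlier
        one is least. Capped at this time \<open>s\<close>, all stopping times agree, so both runs
        have the same configuration at \<open>s\<close>.\<close>
      define i0 where "i0 = arg_min_on (\<lambda>i. min (stop i) (stop' i)) ?bad"
      define s where "s = min (stop i0) (stop' i0)"
      have bad: "finite ?bad" "?bad \<noteq> {}" using that \<open>stop i \<noteq> stop' i\<close> by auto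
      have i0: "i0 < k" "stop i0 \<noteq> stop' i0"
        using arg_min_if_finite(1)[OF bad, of "\<lambda>i. min (stop i) (stop' i)"] unfolding i0_def by auto
      have least: "s \<le> min (stop j) (stop' j)" if "j < k" "stop j \<noteq> stop' j" for j
        using arg_min_least[OF bad, of j "\<lambda>i. min (stop i) (stop' i)"] that unfolding s_def i0_def by auto
      have mins: "min s (stop j) = min s (stop' j)" if "j < k" for j
        using least[OF that] by (cases "stop j = stop' j") auto
      have s: "0 \<le> s" "s \<le> T" "s \<le> T'" using stop[of i0] stop' i0 by (auto simp: s_def)
      have pos_A: "pos s j = comb_point e (A s j)" if "j < k" for j
        using agree mins s that by simp
      show False
      proof (cases "s < T \<and> s < T'")
        case True
        have iff: "blocked ?G k (comb_point e r) (pos s) i0 \<longleftrightarrow> stop i0 \<le> s"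
          using blocked[of k "A s" "pos s" i0] A pos_A inj bl s True i0 by simp
        have "s \<in> {0..<T'}" using s True by simp
        note move' = bspec[OF move this]
        show False
        \<comment> \<open>If \<open>i0\<close> goes on only in the run \<open>pos\<close>, it is
          unblocked there, against \<open>bl\<close>. If it goes on only in \<open>A\<close>, it is
          unblocked, so \<open>pos\<close> must let one server at its point go on; as the servers
          are at distinct points, that server is \<open>i0\<close> itself.\<close>
        proof (cases "stop i0 < stop' i0")
          case True
          then have "s = stop i0" "s < stop' i0" by (simp_all add: s_def)
          then have "\<not> blocked ?G k (comb_point e r) (pos s) i0" using move' i0(1) by blast
          then show False using iff \<open>s = stop i0\<close> by simp
        next
          case False
          then have "s < stop i0" "stop' i0 = s" using i0(2) by (simp_all add: s_def)
          then have "\<not> blocked ?G k (comb_point e r) (pos s) i0" using iff by simp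
          then obtain j where j: "j < k" "pos s j = pos s i0" "s < stop' j"
            using move' i0(1) by blast
          then have "A s j = A s i0" using pos_A comb_point_inj[OF e A A, of j s i0 s] s i0 by simp
          then have "j = i0" using inj_onD[OF inj[of s]] s True j i0 by auto
          then show False using j \<open>stop' i0 = s\<close> by simp
        qed
      next
        case False
        \<comment> \<open>Both runs end at time \<open>s\<close>; the stopping times of
          \<open>i0\<close> are at least \<open>s\<close> and at most the end time, hence
          equal.\<close>
        then have "s = min T T'" using s by linarith
        then have "T' = T" using reach mins by simp
        moreover have "stop' i0 \<le> T'" "stop i0 \<le> T" using stop[of i0] stop' i0(1) by auto
        ultimately show False using i0(2) \<open>s = min T T'\<close> unfolding s_def by linarith
      qed
    qed
    then have "T' = T" using reach by simp
    then show ?thesis using C' agree same T by simp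
  qed
  show "dca_serve ?G k (comb_point e r) C C'" if C': "\<forall>i<k. C' i = comb_point e (A T i)"
    unfolding dca_serve_def
  proof (rule exI[of _ T], rule exI[of _ stop], rule exI[of _ "\<lambda>t i. comb_point e (A t i)"], intro conjI)
    let ?pos = "\<lambda>t i. comb_point e (A t i)"
    show "0 \<le> T" "\<forall>i<k. 0 \<le> stop i \<and> stop i \<le> T" "\<forall>i<k. C' i = ?pos T i"
      "\<exists>i<k. ?pos T i = comb_point e r"
      using T stop C' hit by auto
    show "\<forall>i<k. \<forall>t\<in>{0..T}. ?pos t i \<in> tree_path ?G (C i) (comb_point e r) \<and>
            tree_dist ?G (C i) (?pos t i) = min t (stop i)"
      using tree_path_comb[OF e N A0 A r] path tree_dist_comb[OF e N A0 A] speed C by simp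
    show "\<forall>t\<in>{0..<T}.
           (\<forall>i<k. ?pos t i \<noteq> comb_point e r) \<and>
           (\<forall>i<k. t < stop i \<longrightarrow> \<not> blocked ?G k (comb_point e r) (?pos t) i) \<and>
           (\<forall>i<k. \<not> blocked ?G k (comb_point e r) (?pos t) i \<longrightarrow>
                    (\<exists>!j. j < k \<and> ?pos t j = ?pos t i \<and> t < stop j))"
    proof
      fix t assume "t \<in> {0..<T}"
      then have t: "0 \<le> t" "t < T" by auto
      have iff: "blocked ?G k (comb_point e r) (?pos t) i \<longleftrightarrow> stop i \<le> t" if "i < k" for i
        using blocked[of k "A t" "?pos t" i] A inj bl t that by simp
      have eq: "?pos t j = ?pos t i \<longleftrightarrow> j = i" if "i < k" "j < k" for i j
        using comb_point_inj[OF e A A, of j t i t] inj_onD[OF inj[OF t], of j i] t that by auto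
      have "?pos t i \<noteq> comb_point e r" if "i < k" for i
        using comb_point_inj[OF e A r, of i t] not_r t that by auto
      moreover have "\<exists>!j. j < k \<and> ?pos t j = ?pos t i \<and> t < stop j" if "i < k" "t < stop i" for i
        using eq that by blast
      ultimately show "(\<forall>i<k. ?pos t i \<noteq> comb_point e r) \<and>
           (\<forall>i<k. t < stop i \<longrightarrow> \<not> blocked ?G k (comb_point e r) (?pos t) i) \<and>
           (\<forall>i<k. \<not> blocked ?G k (comb_point e r) (?pos t) i \<longrightarrow>
                    (\<exists>!j. j < k \<and> ?pos t j = ?pos t i \<and> t < stop j))"
        using iff by (simp add: not_le)
    qed
  qed
qed

text \<open>\<open>comb_state e m\<close> is the configuration of DCA just before the request at the tip of tooth \<open>m\<close>.
  Server \<open>m - 1\<close> reaches that tooth before server \<open>0\<close> does, since server \<open>0\<close> is \<open>e / 2\<close> further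
  away, and climbs it; so server \<open>0\<close> stays nearest to the teeth on the left.\<close>

definition comb_state :: "real \<Rightarrow> nat \<Rightarrow> nat \<Rightarrow> real \<times> real" where
  "comb_state e m i =
     (if i = 0 then (real m + 1 + e / 2, 0) else if i < m then (real i, 0)
      else if i = m then (real m + 1, e) else (real i + 1, e / 2))"

text \<open>The request is at tooth \<open>m = p + 1\<close>. Server \<open>p\<close> walks one unit
  to its foot and climbs it; server \<open>0\<close> walks left for time 1; server
  \<open>p + 1\<close>, on the tip of tooth \<open>p + 2\<close>, descends until server
  \<open>0\<close> passes below it.\<close>

definition comb_motion :: "real \<Rightarrow> nat \<Rightarrow> real \<Rightarrow> nat \<Rightarrow> real \<times> real" where
  "comb_motion e p t i =
     (if i = 0 then (real p + 2 + e / 2 - min t 1, 0) else if i < p then (real i, 0)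
      else if i = p then (real p + min t 1, max 0 (t - 1))
      else if i = Suc p then (real p + 2, e - min t (e / 2)) else (real i + 1, e / 2))"

text \<open>Server \<open>0\<close> is stopped at time 1 by server \<open>p\<close> arriving at the
  foot of tooth \<open>p + 1\<close>, and server \<open>p + 1\<close> at time \<open>e / 2\<close>
  by server \<open>0\<close> passing the foot of tooth \<open>p + 2\<close>. Server \<open>p\<close>
  reaches the tip at \<open>1 + e\<close>; all others are blocked from the start.\<close>

definition comb_stop :: "real \<Rightarrow> nat \<Rightarrow> nat \<Rightarrow> real" where
  "comb_stop e p i =
     (if i = 0 then 1 else if i = p then 1 + e else if i = Suc p then e / 2 else 0)"

context
  fixes e t :: real and p k :: nat
  assumes e: "0 < e" "e \<le> 1" and p: "0 < p" and t: "0 \<le> t" "t \<le> 1 + e"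
begin

text \<open>Conditions on \<open>i\<close> are phrased over the reals so that the geometric claims
  below reduce to linear arithmetic in each case.\<close>

lemma comb_motion_cases:
  obtains "real i = 0" "comb_motion e p t i = (real p + 2 + e / 2 - min t 1, 0)" "comb_stop e p i = 1"
  | "1 \<le> real i" "real i + 1 \<le> real p" "comb_motion e p t i = (real i, 0)" "comb_stop e p i = 0"
  | "real i = real p" "comb_motion e p t i = (real p + min t 1, max 0 (t - 1))" "comb_stop e p i = 1 + e"
  | "real i = real p + 1" "comb_motion e p t i = (real p + 2, e - min t (e / 2))" "comb_stop e p i = e / 2"
  | "real p + 2 \<le> real i" "comb_motion e p t i = (real i + 1, e / 2)" "comb_stop e p i = 0"
  using p by (cases "i = 0"; cases i p rule: linorder_cases; cases "i = Suc p")
    (auto simp: comb_motion_def comb_stop_def)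

text \<open>Server \<open>0\<close> starts farthest right, at \<open>p + 2 + e / 2\<close>, which is
  at most \<open>k + 3 / 2\<close>; hence the spine of length \<open>k + 2\<close>.\<close>

lemma comb_motion_coords:
  assumes "i < k" "Suc p \<le> k"
  shows "comb_motion e p t i \<in> comb_coords (k + 2) e"
proof -
  have "real i + 1 \<le> real k" "real p + 1 \<le> real k" using assms by linarith+
  moreover have "1 + real j \<in> \<nat>" "real j + 1 \<in> \<nat>" "real j + 2 \<in> \<nat>" for j by auto
  ultimately show ?thesis
    using e p t
    by (cases rule: comb_motion_cases[of i]) (auto simp: comb_coords_def min_def max_def)
qed

lemma comb_motion_speed:
  "comb_dist (comb_motion e p 0 i) (comb_motion e p t i) = min t (comb_stop e p i)"
  using e p t by (auto simp: comb_motion_def comb_stop_def comb_dist_def min_def max_def)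

lemma comb_motion_path:
  "comb_between (comb_motion e p 0 i) (comb_motion e p t i) (real p + 1, e)"
  using e p t by (auto simp: comb_motion_def comb_between_def comb_dist_def min_def max_def)

text \<open>The close encounters leave a gap of \<open>e / 2\<close>: server \<open>0\<close> passes
  that far below server \<open>p + 1\<close> and stops that far to the right of tooth
  \<open>p + 1\<close>.\<close>

lemma comb_motion_inj: "inj_on (comb_motion e p t) {..<k}"
proof (rule inj_onI)
  fix i j assume "comb_motion e p t i = comb_motion e p t j"
  then have "real i = real j"
    using e p t
    by (cases rule: comb_motion_cases[of i]; cases rule: comb_motion_cases[of j])
      (simp_all add: min_def max_def split: if_splits)
  then show "i = j" by simp
qed

lemma comb_motion_not_request:
  "t < 1 + e \<Longrightarrow> comb_motion e p t i \<noteq> (real p + 1, e)"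
  using e p t
  by (cases rule: comb_motion_cases[of i]) (simp_all add: min_def max_def split: if_splits)

lemma comb_motion_blocked:
  assumes "t < 1 + e" "i < k" "p < k"
  shows "(\<exists>j<k. j \<noteq> i \<and> comb_between (comb_motion e p t i) (comb_motion e p t j) (real p + 1, e))
           \<longleftrightarrow> comb_stop e p i \<le> t" (is "?blocked \<longleftrightarrow> _")
proof (cases "comb_stop e p i \<le> t")
  case True
  \<comment> \<open>Server \<open>p\<close> blocks server \<open>0\<close> and the servers on its
    left; server \<open>0\<close> blocks those with a number above \<open>p\<close>.\<close>
  define j where "j = (if i = 0 \<or> i < p then p else 0)"
  have "comb_between (comb_motion e p t i) (comb_motion e p t j) (real p + 1, e)"
    using True e p t assms
    by (cases rule: comb_motion_cases[of i]; cases rule: comb_motion_cases[of j])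
      (simp_all add: j_def comb_between_def comb_dist_def min_def max_def abs_if split: if_splits)
  moreover have "j < k" "j \<noteq> i"
    using True assms p t by (auto simp: j_def comb_stop_def split: if_splits)
  ultimately show ?thesis using True by blast
next
  case False
  have "\<not> comb_between (comb_motion e p t i) (comb_motion e p t j) (real p + 1, e)" if "real j \<noteq> real i" for j
    using False e p t assms that
    by (cases rule: comb_motion_cases[of i]; cases rule: comb_motion_cases[of j])
      (simp_all add: comb_between_def comb_dist_def min_def max_def abs_if split: if_splits)
  then show ?thesis using False by auto
qed

end

lemma dca_serve_comb_state:
  assumes e: "0 < e" "e \<le> 1" and m: "2 \<le> m" "m \<le> k"
    and C: "\<And>i. i < k \<Longrightarrow> C i = comb_point e (comb_state e m i)"
  shows "dca_serve (comb (k + 2) e) k (comb_point e (real m, e)) C C' \<longleftrightarrow>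
           (\<forall>i<k. C' i = comb_point e (comb_state e (m - 1) i))"
proof -
  \<comment> \<open>Since \<open>m \<ge> 2\<close>, the climbing server \<open>p = m - 1\<close> is
    not server \<open>0\<close>.\<close>
  obtain p where p: "m = Suc p" "0 < p" using m by (cases m) auto
  have start: "comb_motion e p 0 i = comb_state e m i" and
    final: "comb_motion e p (1 + e) i = comb_state e (m - 1) i" for i
    using p e by (auto simp: comb_motion_def comb_state_def)
  have "dca_serve (comb (k + 2) e) k (comb_point e (real p + 1, e)) C C' \<longleftrightarrow>
     (\<forall>i<k. C' i = comb_point e (comb_motion e p (1 + e) i))"
  proof (rule dca_serve_comb[where stop = "comb_stop e p"])
    show "(real p + 1, e) \<in> comb_coords (k + 2) e"
      using e p m by (auto simp: comb_coords_def)
    show "0 \<le> comb_stop e p i \<and> comb_stop e p i \<le> 1 + e" for i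
      using e by (auto simp: comb_stop_def)
    show "C i = comb_point e (comb_motion e p 0 i)" if "i < k" for i
      using C start that by simp
    show "\<exists>i<k. comb_motion e p (1 + e) i = (real p + 1, e)"
      using e p m by (intro exI[of _ p]) (auto simp: comb_motion_def)
  qed (use e p m comb_motion_coords comb_motion_speed comb_motion_path comb_motion_inj
        comb_motion_not_request comb_motion_blocked in auto)
  then show ?thesis using final p by (simp add: add.commute)
qed

section \<open>Costs\<close>

lemma dca_serve_single:
  assumes e: "0 < e" "e \<le> 1" and N: "3 \<le> N" and C: "C 0 = comb_point e (comb_state e 1 0)"
  shows "dca_serve (comb N e) 1 (comb_point e (1, e)) C C' \<longleftrightarrow> C' 0 = comb_point e (1, e)"
proof -
  \<comment> \<open>The lone server walks \<open>1 + e / 2\<close> to the foot of tooth 1 and then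
    climbs \<open>e\<close>.\<close>
  define A where "A t i = (if t \<le> 1 + e / 2 then (2 + e / 2 - t, 0) else (1, t - 1 - e / 2))" for t :: real and i :: nat
  let ?T = "1 + e / 2 + e"
  have "dca_serve (comb N e) 1 (comb_point e (1, e)) C C' \<longleftrightarrow> (\<forall>i<1. C' i = comb_point e (A ?T i))"
  proof (rule dca_serve_comb[where stop = "\<lambda>_. ?T"])
    show "C i = comb_point e (A 0 i)" if "i < 1" for i
      using that C e by (simp add: A_def comb_state_def)
  qed (use e N in \<open>auto simp: A_def comb_coords_def comb_between_def comb_dist_def inj_on_def\<close>)
  also have "A ?T 0 = (1, e)" using e by (simp add: A_def)
  then have "(\<forall>i<1. C' i = comb_point e (A ?T i)) \<longleftrightarrow> C' 0 = comb_point e (1, e)" by simp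
  finally show ?thesis .
qed

text \<open>For \<open>k = 1\<close> the tips \<open>k, ..., 2\<close> would form an empty list; the
  maximum turns this into one request at tooth 1.\<close>

definition comb_requests :: "real \<Rightarrow> nat \<Rightarrow> nat point list" where
  "comb_requests e k = map (\<lambda>t. comb_point e (real (k - t), e)) [0..<max 1 (k - 1)]"

context
  fixes e :: real and k :: nat
  assumes e: "0 < e" "e \<le> 1" and k: "1 \<le> k"
begin

abbreviation "caterpillar \<equiv> comb (k + 2) e"
abbreviation "start_config \<equiv> (\<lambda>i. comb_point e (comb_state e k i))"
abbreviation "requests \<equiv> comb_requests e k"

lemma comb_state_coords: "i < k \<Longrightarrow> m \<le> k \<Longrightarrow> comb_state e m i \<in> comb_coords (k + 2) e"
proof -
  assume "i < k" "m \<le> k"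
  then have "real i + 1 \<le> real k" "real m \<le> real k" by simp_all
  moreover have "1 + real j \<in> \<nat>" "real j + 1 \<in> \<nat>" for j by auto
  ultimately show ?thesis using e by (auto simp: comb_state_def comb_coords_def)
qed

lemma tip_coords: "m \<le> k \<Longrightarrow> (real m, e) \<in> comb_coords (k + 2) e"
  using e by (auto simp: comb_coords_def)

lemma tree_points_caterpillar: "tree_points caterpillar = comb_point e ` comb_coords (k + 2) e"
  using tree_points_comb[of e "k + 2"] e by simp

lemma tree_dist_caterpillar:
  "a \<in> comb_coords (k + 2) e \<Longrightarrow> b \<in> comb_coords (k + 2) e \<Longrightarrow>
     tree_dist caterpillar (comb_point e a) (comb_point e b) = comb_dist a b"
  using tree_dist_comb[of e "k + 2"] e by simp

lemma requests_points: "set requests \<subseteq> tree_points caterpillar"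
proof -
  have "comb_point e (real (k - t), e) \<in> tree_points caterpillar" for t
    unfolding tree_points_caterpillar by (intro imageI tip_coords) simp
  then show ?thesis unfolding comb_requests_def set_map by blast
qed

lemma length_requests: "length requests = max 1 (k - 1)"
  by (simp add: comb_requests_def)

lemma nth_requests: "t < max 1 (k - 1) \<Longrightarrow> requests ! t = comb_point e (real (k - t), e)"
  by (simp add: comb_requests_def)

section \<open>The offline optimum\<close>

lemma offline_cost_ge:
  assumes "offline_solution caterpillar k start_config requests cs"
  shows "1 \<le> (\<Sum>i<k. server_cost caterpillar cs i)"
proof -
  have cs: "length cs = Suc (length requests)" "cs ! 0 = start_config"
    "\<And>t i. t \<le> length requests \<Longrightarrow> i < k \<Longrightarrow> (cs ! t) i \<in> tree_points caterpillar"
    "\<And>t. t < length requests \<Longrightarrow> \<exists>i<k. (cs ! Suc t) i = requests ! t"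
    using assms unfolding offline_solution_def by auto
  have nonneg: "0 \<le> tree_dist caterpillar ((cs ! t) i) ((cs ! Suc t) i)" if "t < length requests" "i < k" for t i
    using cs(3)[of t i] cs(3)[of "Suc t" i] that tree_dist_caterpillar comb_dist_nonneg
    unfolding tree_points_caterpillar by fastforce
  have len: "0 < length requests" by (simp add: length_requests)
  then obtain i where i: "i < k" "(cs ! Suc 0) i = requests ! 0" using cs(4) by blast
  have "requests ! 0 = comb_point e (real k, e)" using nth_requests[of 0] by simp
  then have "tree_dist caterpillar ((cs ! 0) i) ((cs ! Suc 0) i) = comb_dist (comb_state e k i) (real k, e)"
    using cs(2) i comb_state_coords tip_coords tree_dist_caterpillar by simp
  \<comment> \<open>Every server starts at horizontal distance at least 1 from tooth
    \<open>k\<close>.\<close>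
  also have "\<dots> \<ge> 1" using e i(1) by (auto simp: comb_dist_def comb_state_def)
  finally have "1 \<le> tree_dist caterpillar ((cs ! 0) i) ((cs ! Suc 0) i)" .
  also have "\<dots> \<le> server_cost caterpillar cs i"
    unfolding server_cost_def
    by (rule member_le_sum) (use len nonneg i cs(1) in auto)
  also have "\<dots> \<le> (\<Sum>i<k. server_cost caterpillar cs i)"
    by (rule member_le_sum) (use nonneg i cs(1) in \<open>auto simp: server_cost_def intro!: sum_nonneg\<close>)
  finally show ?thesis .
qed

text \<open>All servers move at the first request and rest afterwards, so the whole cost is
  \<open>1 + e / 2 + e\<close> for server \<open>0\<close> and \<open>e\<close> for each other
  server.\<close>

lemma offline_solution_tips:
  defines "F \<equiv> \<lambda>i. comb_point e (if i = 0 then real k else real i, e)"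
  defines "cs \<equiv> start_config # replicate (length requests) F"
  shows "offline_solution caterpillar k start_config requests cs" "(\<Sum>i<k. server_cost caterpillar cs i) = 1 + e / 2 + real k * e"
proof -
  have F: "F i \<in> tree_points caterpillar" if "i < k" for i
    unfolding F_def tree_points_caterpillar using tip_coords that by auto
  have start: "start_config i \<in> tree_points caterpillar" if "i < k" for i
    unfolding tree_points_caterpillar using comb_state_coords that by auto
  have serve: "\<exists>i<k. F i = requests ! t" if "t < length requests" for t
  proof -
    have t: "t < max 1 (k - 1)" using that length_requests by simp
    show ?thesis
      unfolding nth_requests[OF t] F_def using k t
      \<comment> \<open>The first request, tip \<open>k\<close>, belongs to server \<open>0\<close>;
        a later one is at tip \<open>k - t\<close>, on the own tooth of server
        \<open>k - t\<close>.\<close>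
      by (intro exI[of _ "if t = 0 then 0 else k - t"]) auto
  qed
  show "offline_solution caterpillar k start_config requests cs"
    using F start serve unfolding offline_solution_def cs_def
    by (auto simp: nth_Cons split: nat.split)
  have cost: "server_cost caterpillar cs i = (if i = 0 then 1 + e / 2 + e else e)" if "i < k" for i
  proof -
    have "0 < length requests" by (simp add: length_requests)
    then obtain n where n: "length requests = Suc n" using gr0_conv_Suc by blast
    have coords: "(if i = 0 then real k else real i, e) \<in> comb_coords (k + 2) e"
      using tip_coords that by auto
    have "tree_dist caterpillar (F i) (F i) = 0"
      unfolding F_def using tree_dist_caterpillar[OF coords coords] by (simp add: comb_dist_def)
    moreover have "tree_dist caterpillar (start_config i) (F i) = (if i = 0 then 1 + e / 2 + e else e)"
      unfolding F_def using tree_dist_caterpillar[OF comb_state_coords coords] that e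
      by (auto simp: comb_dist_def comb_state_def)
    ultimately have "tree_dist caterpillar ((cs ! t) i) ((cs ! Suc t) i) =
        (if t = 0 then if i = 0 then 1 + e / 2 + e else e else 0)" if "t < Suc n" for t
      using that unfolding cs_def n by (cases t) (auto simp del: replicate_Suc)
    moreover have "length cs - 1 = Suc n" by (simp add: cs_def n)
    ultimately show ?thesis unfolding server_cost_def by simp
  qed
  obtain l where l: "k = Suc l" using k by (cases k) auto
  have "(\<Sum>i<k. server_cost caterpillar cs i) = (\<Sum>i<k. if i = 0 then 1 + e / 2 + e else e)"
    using cost by (intro sum.cong) auto
  also have "\<dots> = 1 + e / 2 + real k * e"
    unfolding l by (simp add: sum.lessThan_Suc_shift algebra_simps del: sum.lessThan_Suc)
  finally show "(\<Sum>i<k. server_cost caterpillar cs i) = 1 + e / 2 + real k * e" .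
qed

text \<open>The lower bound on all offline costs also makes the set of costs bounded below, so that
  its infimum is at most each of its members.\<close>

lemma OPT_bounds:
  "1 \<le> OPT caterpillar k start_config requests" "OPT caterpillar k start_config requests \<le> 1 + e / 2 + real k * e"
proof -
  let ?X = "{(\<Sum>i<k. server_cost caterpillar cs i) | cs. offline_solution caterpillar k start_config requests cs}"
  have mem: "1 + e / 2 + real k * e \<in> ?X"
    using offline_solution_tips(1) offline_solution_tips(2)[symmetric] by blast
  have ge: "1 \<le> x" if "x \<in> ?X" for x using that offline_cost_ge by blast
  show "1 \<le> OPT caterpillar k start_config requests"
    unfolding OPT_def by (rule cInf_greatest[OF _ ge]) (use mem in blast)
  have "bdd_below ?X" using ge by (rule bdd_belowI)
  then show "OPT caterpillar k start_config requests \<le> 1 + e / 2 + real k * e"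
    unfolding OPT_def using mem by (rule cInf_lower[rotated])
qed

section \<open>The cost of DCA\<close>

lemma dca_run_states:
  assumes k2: "2 \<le> k"
  shows "dca_run caterpillar k start_config requests (map (\<lambda>t i. comb_point e (comb_state e (k - t) i)) [0..<k])"
    (is "dca_run _ _ _ _ ?cs")
proof -
  have "dca_serve caterpillar k (requests ! t) (?cs ! t) (?cs ! Suc t)" if "t < k - 1" for t
    using dca_serve_comb_state[OF e, of "k - t" k] nth_requests[of t] that by simp
  then show ?thesis using k2 length_requests by (simp add: dca_run_def)
qed

text \<open>Every run is forced: \<open>dca_serve_comb_state\<close> is an equivalence, and it
  applies at each request because \<open>k - t \<ge> 2\<close> for \<open>t < k - 1\<close>.\<close>

lemma dca_run_config:
  assumes "2 \<le> k" "dca_run caterpillar k start_config requests cs" "t \<le> k - 1" "i < k"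
  shows "(cs ! t) i = comb_point e (comb_state e (k - t) i)"
  using assms(3,4)
proof (induction t arbitrary: i)
  case 0
  then show ?case using assms(2) by (simp add: dca_run_def)
next
  case (Suc t)
  have "t < length requests" using Suc.prems length_requests by simp
  then have "dca_serve caterpillar k (comb_point e (real (k - t), e)) (cs ! t) (cs ! Suc t)"
    using assms(2) length_requests nth_requests[of t] unfolding dca_run_def by metis
  then show ?case
    using dca_serve_comb_state[OF e, of "k - t" k "cs ! t" "cs ! Suc t"] Suc by simp
qed

text \<open>Each of the \<open>k - 1\<close> requests brings server \<open>0\<close> one unit
  further left.\<close>

lemma dca_run_cost:
  assumes "2 \<le> k" "dca_run caterpillar k start_config requests cs"
  shows "server_cost caterpillar cs 0 = real k - 1"
proof -
  have "tree_dist caterpillar ((cs ! t) 0) ((cs ! Suc t) 0) = 1" if t: "t < k - 1" for t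
  proof -
    have "tree_dist caterpillar ((cs ! t) 0) ((cs ! Suc t) 0) =
        comb_dist (comb_state e (k - t) 0) (comb_state e (k - Suc t) 0)"
      using dca_run_config[OF assms, of t 0] dca_run_config[OF assms, of "Suc t" 0] t
        tree_dist_caterpillar comb_state_coords by simp
    also have "\<dots> = 1" using t by (simp add: comb_dist_def comb_state_def of_nat_diff)
    finally show ?thesis .
  qed
  moreover have "length cs - 1 = k - 1"
    using assms length_requests by (simp add: dca_run_def)
  ultimately show ?thesis using k by (simp add: server_cost_def of_nat_diff)
qed

end

theorem theorem12:
  "\<exists>c::real. c > 0 \<and>
     (\<forall>k::nat. k \<ge> 1 \<longrightarrow>
        (\<exists>(G :: nat wgraph) (C :: nat config) (\<sigma> :: nat point list).
           weighted_tree G \<and>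
           (\<forall>i<k. C i \<in> tree_points G) \<and>
           set \<sigma> \<subseteq> tree_points G \<and>
           OPT G k C \<sigma> > 0 \<and>
           (\<exists>cs. dca_run G k C \<sigma> cs) \<and>
           (\<forall>cs. dca_run G k C \<sigma> cs \<longrightarrow>
              (\<exists>i<k. server_cost G cs i \<ge> c * real k * OPT G k C \<sigma>))))"
\<comment> \<open>Server \<open>0\<close> pays at least \<open>k / 2\<close> and the optimum is at
  most 3, whence the factor \<open>1 / 6\<close>.\<close>
proof (intro exI[of _ "1 / 6"] conjI allI impI)
  fix k :: nat assume k: "1 \<le> k"
  \<comment> \<open>The \<open>k\<close> teeth climbed offline then have total length 1, which keeps
    the optimum bounded.\<close>
  define e where "e = 1 / real k"
  have e: "0 < e" "e \<le> 1" "real k * e = 1" using k by (simp_all add: e_def)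
  let ?G = "comb (k + 2) e" and ?C = "\<lambda>i. comb_point e (comb_state e k i)" and ?\<sigma> = "comb_requests e k"
  have opt: "1 \<le> OPT ?G k ?C ?\<sigma>" "OPT ?G k ?C ?\<sigma> \<le> 3"
    using OPT_bounds[OF e(1,2) k] e by linarith+
  have run: "(\<exists>cs. dca_run ?G k ?C ?\<sigma> cs) \<and>
    (\<forall>cs. dca_run ?G k ?C ?\<sigma> cs \<longrightarrow> real k / 2 \<le> server_cost ?G cs 0)"
  proof (cases "k = 1")
    case True
    then have e1: "e = 1" by (simp add: e_def)
    have serve: "dca_serve ?G k (?\<sigma> ! 0) ?C C' \<longleftrightarrow> C' 0 = comb_point e (1, e)" for C'
      using dca_serve_single[OF e(1,2), of "k + 2" ?C C'] True by (simp add: comb_requests_def)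
    have len: "length ?\<sigma> = 1" using True by (simp add: comb_requests_def)
    have "dca_run ?G k ?C ?\<sigma> [?C, \<lambda>_. comb_point e (1, e)]"
      using serve len by (simp add: dca_run_def)
    moreover have "real k / 2 \<le> server_cost ?G cs 0" if "dca_run ?G k ?C ?\<sigma> cs" for cs
    proof -
      have cs: "length cs = 2" "cs ! 0 = ?C" "(cs ! Suc 0) 0 = comb_point e (1, e)"
        using that len serve[of "cs ! 1"] by (auto simp: dca_run_def)
      have "tree_dist ?G (?C 0) (comb_point e (1, e)) = comb_dist (comb_state e k 0) (1, e)"
        using tree_dist_caterpillar[OF e(1,2) k comb_state_coords[OF e(1,2) k] tip_coords[OF e(1,2) k, of 1]] k by simp
      then show ?thesis
        using cs True e1 by (simp add: server_cost_def comb_dist_def comb_state_def)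
    qed
    ultimately show ?thesis by blast
  next
    case False
    then have k2: "2 \<le> k" using k by simp
    then have "real k / 2 \<le> real k - 1" by simp
    then show ?thesis using dca_run_states[OF e(1,2) k k2] dca_run_cost[OF e(1,2) k k2] by auto
  qed
  have bound: "1 / 6 * real k * OPT ?G k ?C ?\<sigma> \<le> real k / 2"
    using mult_left_mono[OF opt(2), of "real k / 6"] by simp
  have cost: "\<exists>i<k. 1 / 6 * real k * OPT ?G k ?C ?\<sigma> \<le> server_cost ?G cs i"
    if "dca_run ?G k ?C ?\<sigma> cs" for cs
  proof -
    have "real k / 2 \<le> server_cost ?G cs 0" using run that by blast
    then have "1 / 6 * real k * OPT ?G k ?C ?\<sigma> \<le> server_cost ?G cs 0" using bound by linarith
    then show ?thesis using k by (intro exI[of _ 0]) simp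
  qed
  have points: "\<forall>i<k. ?C i \<in> tree_points ?G"
    using comb_state_coords[OF e(1,2) k] tree_points_caterpillar[OF e(1,2) k] by auto
  show "\<exists>(G :: nat wgraph) (C :: nat config) (\<sigma> :: nat point list).
           weighted_tree G \<and>
           (\<forall>i<k. C i \<in> tree_points G) \<and>
           set \<sigma> \<subseteq> tree_points G \<and>
           OPT G k C \<sigma> > 0 \<and>
           (\<exists>cs. dca_run G k C \<sigma> cs) \<and>
           (\<forall>cs. dca_run G k C \<sigma> cs \<longrightarrow>
              (\<exists>i<k. server_cost G cs i \<ge> 1 / 6 * real k * OPT G k C \<sigma>))"
  proof (rule exI[of _ ?G], rule exI[of _ ?C], rule exI[of _ ?\<sigma>], intro conjI allI impI)
    show "weighted_tree ?G" using weighted_tree_comb e(1) by blast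
    show "set ?\<sigma> \<subseteq> tree_points ?G" using requests_points[OF e(1,2) k] .
    show "0 < OPT ?G k ?C ?\<sigma>" using opt(1) by linarith
    show "\<exists>cs. dca_run ?G k ?C ?\<sigma> cs" using run by blast
  qed (use points cost in blast)+
qed simp

end
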